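(* Let $(\mathfrak g=\mathfrak g_{\bar 0}\oplus\mathfrak g_{\bar 1},B)$ be an odd-quadratic Lie superalgebra with $\dim\mathfrak g_{\bar 1}=m\ge 3$ and $\dim\mathfrak g>1$, such that $\mathfrak g_{\bar 1}$ is a weak filiform $\mathfrak g_{\bar 0}$-module with respect to the flag $\mathfrak g_{\bar 1}=V_m\supset\dots\supset V_2\supset V_1=\{0\}$, and write $V_m/V_{m-1}=\mathbb Ke_m$. Then $(\mathfrak g,B)$ is a generalized odd double extension of an odd-quadratic Lie superalgebra $(\mathfrak h,\widetilde B)$ with $\dim\mathfrak h=\dim\mathfrak g-2$ by the one-dimensional Lie superalgebra $(\mathbb Ke_m)_{\bar 1}$. Furthermore, $\mathfrak h_{\bar 1}$ is a weak filiform $\mathfrak h_{\bar 0}$-module with respect to the flag $$\mathfrak h_{\bar 1}=V_{m-1}\supset\dots\supset V_2\supset V_1=\{0\}.$$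
   Context: All Lie superalgebras are finite-dimensional over an algebraically closed field $\mathbb K$ of characteristic zero. A Lie superalgebra $\mathfrak g=\mathfrak g_{\bar 0}\oplus\mathfrak g_{\bar 1}$ is odd-quadratic, written $(\mathfrak g,B)$, if it carries a bilinear form $B:\mathfrak g\times\mathfrak g\to\mathbb K$ (an odd-invariant scalar product) that is supersymmetric ($B(X,Y)=(-1)^{ij}B(Y,X)$ for $X\in\mathfrak g_{\bar i},Y\in\mathfrak g_{\bar j}$), invariant ($B([X,Y],Z)=B(X,[Y,Z])$), odd ($B(\mathfrak g_{\bar 0},\mathfrak g_{\bar 0})=B(\mathfrak g_{\bar 1},\mathfrak g_{\bar 1})=0$) and non-degenerate. If $\dim\mathfrak g_{\bar 1}=m>0$, then $\mathfrak g_{\bar 1}$ is a weak filiform $\mathfrak g_{\bar 0}$-module if there is a flag of subspaces $\mathfrak g_{\bar 1}=V_m\supset V_{m-1}\supset\dots\supset V_2\supset V_1=\{0\}$ with $\dim V_i=i$ and $[\mathfrak g_{\bar 0},V_i]=V_{i-1}$ for all $i\in\{2,\dots,m\}$, where $[\mathfrak g_{\bar 0},V_i]$ denotes the linear span of brackets (the flag jumps from dimension $2$ to dimension $0$). Notation $V_i/V_{i-1}=\mathbb Ke_i$ for $3\le i\le m$ means that $e_i\in V_i$ represents a basis of the quotient. Generalized odd double extension: let $(\mathfrak h,\widetilde B)$ be an odd-quadratic Lie superalgebra, $D$ an odd skew-supersymmetric superderivation of it, i.e. an odd linear map with $D([X,Y])=[D(X),Y]+(-1)^{i}[X,D(Y)]$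 and $\widetilde B(D(X),Y)=-(-1)^{i}\widetilde B(X,D(Y))$ for $X\in\mathfrak h_{\bar i}$, $Y\in\mathfrak h$, and let $X_0\in\mathfrak h_{\bar 0}$, $\lambda_0\in\mathbb K$ satisfy $D(X_0)=0$ and $D^2=\frac12[X_0,\cdot]_{\mathfrak h}$. (When $\mathfrak h_{\bar 1}$ is weak filiform with flag $V_n\supset\dots\supset V_2\supset V_1=\{0\}$, $n\ge 3$, the construction in the paper also requires $e_n\in D(\mathfrak h_{\bar 0})$ for a vector $e_n$ with $V_n/V_{n-1}=\mathbb Ke_n$.) The generalized odd double extension of $(\mathfrak h,\widetilde B)$ by the one-dimensional Lie superalgebra $(\mathbb Ke)_{\bar 1}$ (with $e$ odd), by means of $D,X_0,\lambda_0$, is $\mathfrak t=\mathbb Ke\oplus\mathfrak h\oplus\mathbb Ke^*$ with $e$ odd and $e^*$ even, with bracket $[e,e]=X_0+\lambda_0e^*$, $[e,X]=D(X)-(-1)^{i}\widetilde B(X,X_0)e^*$ for $X\in\mathfrak h_{\bar i}$, $[X,Y]=[X,Y]_{\mathfrak h}+\widetilde B(D(X),Y)e^*$ for $X,Y\in\mathfrak h$, $[e^*,\mathfrak t]=0$, and with the odd-invariant scalar product that restricts to $\widetilde B$ on $\mathfrak h$, pairs $e$ and $e^*$ to $1$, and makes $\mathfrak h$ orthogonal to $e$ and $e^*$. *)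

theory Defs
  imports "HOL-Library.Z2" "HOL-Computational_Algebra.Polynomial"
begin

text \<open>
  A superspace is a family of subspaces \<open>G :: bit \<Rightarrow> 'v set\<close> of an ambient vector space, where
  \<open>G 0\<close> is the even and \<open>G 1\<close> the odd part.  Parities are added and multiplied in the field
  \<open>bit\<close> of two elements.  Brackets, forms and superderivations are total functions on the ambient
  type, but only their values on \<open>total G\<close> matter.
\<close>

definition psign :: "bit \<Rightarrow> 'k::ring_1"
  where "psign i = (if i = 0 then 1 else - 1)"

definition total :: "(bit \<Rightarrow> 'v::ab_group_add set) \<Rightarrow> 'v set"
  where "total G = {x + y |x y. x \<in> G 0 \<and> y \<in> G 1}"

definition linear_map_on ::
  "('k \<Rightarrow> 'v::plus \<Rightarrow> 'v) \<Rightarrow> ('k \<Rightarrow> 'w::plus \<Rightarrow> 'w) \<Rightarrow> 'v set \<Rightarrow> ('v \<Rightarrow> 'w) \<Rightarrow> bool"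
  where "linear_map_on s1 s2 S f \<longleftrightarrow>
    (\<forall>x\<in>S. \<forall>y\<in>S. f (x + y) = f x + f y) \<and> (\<forall>c. \<forall>x\<in>S. f (s1 c x) = s2 c (f x))"

definition bilinear_map_on ::
  "('k \<Rightarrow> 'v::plus \<Rightarrow> 'v) \<Rightarrow> ('k \<Rightarrow> 'w::plus \<Rightarrow> 'w) \<Rightarrow> 'v set \<Rightarrow> ('v \<Rightarrow> 'v \<Rightarrow> 'w) \<Rightarrow> bool"
  where "bilinear_map_on s1 s2 S f \<longleftrightarrow>
    (\<forall>x\<in>S. linear_map_on s1 s2 S (\<lambda>y. f x y)) \<and> (\<forall>y\<in>S. linear_map_on s1 s2 S (\<lambda>x. f x y))"

locale lie_superalgebra = vector_space scale
  for scale :: "'k::{alg_closed_field, field_char_0} \<Rightarrow> 'v::ab_group_add \<Rightarrow> 'v" +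
  fixes G :: "bit \<Rightarrow> 'v set" and br :: "'v \<Rightarrow> 'v \<Rightarrow> 'v"
  assumes subspace_part: "subspace (G i)"
    and finite_dim_part: "\<exists>S. finite S \<and> span S = G i"
    and direct_sum: "G 0 \<inter> G 1 = {0}"
    and br_bilinear: "bilinear_map_on scale scale (total G) br"
    and br_graded: "x \<in> G i \<Longrightarrow> y \<in> G j \<Longrightarrow> br x y \<in> G (i + j)"
    and br_super_skew: "x \<in> G i \<Longrightarrow> y \<in> G j \<Longrightarrow> br x y = - scale (psign (i * j)) (br y x)"
    and super_jacobi: "x \<in> G i \<Longrightarrow> y \<in> G j \<Longrightarrow> z \<in> total G \<Longrightarrow>
      br x (br y z) = br (br x y) z + scale (psign (i * j)) (br y (br x z))"
begin

text \<open>
  The flag \<open>V m \<supset> \<dots> \<supset> V 2 \<supset> V 1\<close> of the odd part is indexed by dimension except at the bottom,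
  where \<open>V 1\<close> is the zero space.  Values of \<open>V\<close> outside \<open>{1..m}\<close> are irrelevant.
\<close>
definition weak_filiform :: "nat \<Rightarrow> (nat \<Rightarrow> 'v set) \<Rightarrow> bool"
  where "weak_filiform m V \<longleftrightarrow>
    m > 0 \<and> dim (G 1) = m \<and> V m = G 1 \<and> V 1 = {0} \<and>
    (\<forall>i\<in>{2..m}. subspace (V i) \<and> dim (V i) = i \<and> V (i - 1) \<subset> V i \<and>
      span {br x v |x v. x \<in> G 0 \<and> v \<in> V i} = V (i - 1))"

end

text \<open>The class of \<open>e\<close> is a basis of the quotient \<open>W / U\<close>.\<close>
definition (in vector_space) quotient_basis :: "'b set \<Rightarrow> 'b set \<Rightarrow> 'b \<Rightarrow> bool"
  where "quotient_basis W U e \<longleftrightarrow> e \<in> W \<and> e \<notin> U \<and> (\<forall>w\<in>W. \<exists>c. w - scale c e \<in> U)"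

locale odd_quadratic_lie_superalgebra = lie_superalgebra scale G br
  for scale :: "'k::{alg_closed_field, field_char_0} \<Rightarrow> 'v::ab_group_add \<Rightarrow> 'v"
    and G :: "bit \<Rightarrow> 'v set" and br :: "'v \<Rightarrow> 'v \<Rightarrow> 'v" +
  fixes B :: "'v \<Rightarrow> 'v \<Rightarrow> 'k"
  assumes form_bilinear: "bilinear_map_on scale (*) (total G) B"
    and form_supersymmetric: "x \<in> G i \<Longrightarrow> y \<in> G j \<Longrightarrow> B x y = psign (i * j) * B y x"
    and form_invariant:
      "x \<in> total G \<Longrightarrow> y \<in> total G \<Longrightarrow> z \<in> total G \<Longrightarrow> B (br x y) z = B x (br y z)"
    and form_odd: "x \<in> G i \<Longrightarrow> y \<in> G i \<Longrightarrow> B x y = 0"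
    and form_nondegenerate: "x \<in> total G \<Longrightarrow> (\<And>y. y \<in> total G \<Longrightarrow> B x y = 0) \<Longrightarrow> x = 0"
begin

definition odd_skew_superderivation :: "('v \<Rightarrow> 'v) \<Rightarrow> bool"
  where "odd_skew_superderivation D \<longleftrightarrow>
    linear_map_on scale scale (total G) D \<and>
    (\<forall>i. \<forall>x\<in>G i. D x \<in> G (i + 1)) \<and>
    (\<forall>i. \<forall>x\<in>G i. \<forall>y\<in>total G. D (br x y) = br (D x) y + scale (psign i) (br x (D y))) \<and>
    (\<forall>i. \<forall>x\<in>G i. \<forall>y\<in>total G. B (D x) y = - psign i * B x (D y))"

end

text \<open>
  \<open>(T, brT, BT)\<close> is the generalized odd double extension of \<open>(H, brH, BH)\<close> by the odd line spanned
  by \<open>e\<close>, by means of \<open>D\<close>, \<open>X0\<close>, \<open>lam\<close>.  The decomposition \<open>T = K e + H + K e'\<close> (with \<open>e'\<close> in the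
  role of \<open>e\<^sup>*\<close>) is an internal direct sum of superspaces: \<open>H\<close> is a graded subspace of \<open>T\<close>
  with a bracket of its own, and in general not a subalgebra.  Since \<open>T\<close> is itself assumed to be
  odd-quadratic, the remaining brackets and values of the form follow by bilinearity and
  supersymmetry.  The assumption \<open>flag_top\<close> needs no fixed flag, as the flag of a weak filiform
  module is determined by the module.
\<close>
locale generalized_odd_double_extension =
  t: odd_quadratic_lie_superalgebra scale T brT BT +
  h: odd_quadratic_lie_superalgebra scale H brH BH
  for scale :: "'k::{alg_closed_field, field_char_0} \<Rightarrow> 'v::ab_group_add \<Rightarrow> 'v"
    and T :: "bit \<Rightarrow> 'v set" and brT :: "'v \<Rightarrow> 'v \<Rightarrow> 'v" and BT :: "'v \<Rightarrow> 'v \<Rightarrow> 'k"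
    and H :: "bit \<Rightarrow> 'v set" and brH :: "'v \<Rightarrow> 'v \<Rightarrow> 'v" and BH :: "'v \<Rightarrow> 'v \<Rightarrow> 'k" +
  fixes D :: "'v \<Rightarrow> 'v" and X0 :: 'v and lam :: 'k and e :: 'v and e' :: 'v
  assumes derivation: "h.odd_skew_superderivation D"
    and X0_even: "X0 \<in> H 0"
    and D_X0: "D X0 = 0"
    and D_square: "x \<in> total H \<Longrightarrow> D (D x) = scale (1 / 2) (brH X0 x)"
    and flag_top: "h.weak_filiform n V \<Longrightarrow> n \<ge> 3 \<Longrightarrow>
      \<exists>en. t.quotient_basis (V n) (V (n - 1)) en \<and> en \<in> D ` H 0"
    and even_part: "T 0 = {x + scale c e' |x c. x \<in> H 0}" "e' \<notin> H 0"
    and odd_part: "T 1 = {scale c e + x |c x. x \<in> H 1}" "e \<notin> H 1"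
    and br_e_e: "brT e e = X0 + scale lam e'"
    and br_e_H: "x \<in> H i \<Longrightarrow> brT e x = D x - scale (psign i * BH x X0) e'"
    and br_H_H: "x \<in> total H \<Longrightarrow> y \<in> total H \<Longrightarrow> brT x y = brH x y + scale (BH (D x) y) e'"
    and br_e': "x \<in> total T \<Longrightarrow> brT e' x = 0"
    and form_H: "x \<in> total H \<Longrightarrow> y \<in> total H \<Longrightarrow> BT x y = BH x y"
    and form_e_e': "BT e e' = 1"
    and form_orthogonal: "x \<in> total H \<Longrightarrow> BT x e = 0" "x \<in> total H \<Longrightarrow> BT x e' = 0"

end

theory Submission
  imports Defs
begin

text \<open>
  Choosing \<open>e\<close> as the odd line of the extension forces the rest.  The line \<open>\<K>e\<^sup>*\<close> must be
  central, even and dual to \<open>e\<close>, and \<open>\<hh>\<close> must be \<open>{e, e\<^sup>*}\<^sup>\<bottom>\<close>; the odd part of \<open>\<hh>\<close> is then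
  \<open>V (m - 1)\<close> exactly if \<open>e\<^sup>*\<close> spans the orthogonal of \<open>V (m - 1)\<close> in the even part.  So let \<open>u\<close> be
  the even vector with \<open>B u e = 1\<close> and \<open>B u (V (m - 1)) = 0\<close>, which exists because the form pairs
  the even and the odd part perfectly (\<open>odd_functional_represented\<close>).  The filiform condition
  enters through \<open>V (m - 1) = [\<gg>\<^sub>0, \<gg>\<^sub>1]\<close>: by invariance, \<open>u \<bottom> [\<gg>\<^sub>0, \<gg>\<^sub>1]\<close> says that \<open>[u, \<gg>\<^sub>0]\<close> is
  orthogonal to \<open>\<gg>\<^sub>1\<close> and that \<open>[u, \<gg>\<^sub>1]\<close> is orthogonal to \<open>\<gg>\<^sub>0\<close>, so \<open>u\<close> is central
  (\<open>central_if_orthogonal_to_brackets\<close>).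

  Everything else is reduction by the isotropic central line \<open>\<K>u\<close>.  Since \<open>u\<close> is central, all
  brackets lie in \<open>u\<^sup>\<bottom>\<close>, which is an ideal, and \<open>u\<^sup>\<bottom> / \<K>u\<close> is again odd-quadratic; \<open>\<hh>\<close> is the
  system of representatives orthogonal to \<open>e\<close> (\<open>perp_odd_quadratic\<close>).  The derivation \<open>D\<close> is induced
  by \<open>[e, \<cdot>]\<close>, and \<open>X\<^sub>0\<close>, \<open>\<lambda>\<^sub>0\<close> are the components of \<open>[e, e]\<close>.  The conditions \<open>D X\<^sub>0 = 0\<close> and
  \<open>D\<^sup>2 = [X\<^sub>0, \<cdot>] / 2\<close> are the Jacobi identities \<open>[e, [e, e]] = 0\<close> and
  \<open>[e, [e, x]] = [[e, e], x] / 2\<close>, and the \<open>u\<close>-components of the brackets are read off by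
  pairing them with \<open>e\<close> (\<open>is_generalized_odd_double_extension\<close>).

  The flag survives because passing from \<open>\<gg>\<^sub>0\<close> to \<open>\<hh>\<^sub>0\<close> only drops the central \<open>u\<close>
  (\<open>perp_weak_filiform\<close>), and \<open>D \<hh>\<^sub>0\<close> is not contained in \<open>V (m - 2)\<close>, as otherwise
  \<open>[\<gg>\<^sub>0, \<gg>\<^sub>1]\<close> would be too small (\<open>perp_der_reaches_flag_top\<close>).
\<close>

section \<open>Linear functionals and quotients of dimension one\<close>

lemma linear_map_on_subset:
  "linear_map_on s1 s2 S f \<Longrightarrow> T \<subseteq> S \<Longrightarrow> linear_map_on s1 s2 T f"
  unfolding linear_map_on_def by blast

lemma bilinear_map_on_subset:
  "bilinear_map_on s1 s2 S f \<Longrightarrow> T \<subseteq> S \<Longrightarrow> bilinear_map_on s1 s2 T f"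
  unfolding bilinear_map_on_def linear_map_on_def by blast

context vector_space
begin

text \<open>
  Induction on the number of functionals: on the kernel \<open>K\<close> of one of them, \<open>g\<close> is a combination of
  the others, so the difference of \<open>g\<close> and this combination vanishes on \<open>K\<close>, which makes it a
  multiple of the functional with kernel \<open>K\<close>.
\<close>

lemma functional_eq_sum_if_common_kernel:
  fixes f :: "'c \<Rightarrow> 'b \<Rightarrow> 'a"
  assumes "finite I" and "subspace S"
    and "\<And>i. i \<in> I \<Longrightarrow> linear_map_on scale (*) S (f i)" and "linear_map_on scale (*) S g"
    and "\<And>x. x \<in> S \<Longrightarrow> (\<And>i. i \<in> I \<Longrightarrow> f i x = 0) \<Longrightarrow> g x = 0"
  shows "\<exists>c. \<forall>x\<in>S. g x = (\<Sum>i\<in>I. c i * f i x)"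
  using assms
proof (induction I arbitrary: S rule: finite_induct)
  case empty
  then show ?case by auto
next
  case (insert i I)
  note S = \<open>subspace S\<close>
  have fi: "linear_map_on scale (*) S (f i)" using insert.prems by auto
  define K where "K = {x \<in> S. f i x = 0}"
  have zero: "f i 0 = 0"
    using fi subspace_0[OF S] unfolding linear_map_on_def by (metis mult_zero_left scale_zero_left)
  have "subspace K"
    using S fi zero unfolding K_def linear_map_on_def
    by (auto simp: subspace_def)
  moreover have "linear_map_on scale (*) K (f j)" if "j \<in> I" for j
    using insert.prems that by (auto intro: linear_map_on_subset[of _ _ S] simp: K_def)
  moreover have "linear_map_on scale (*) K g"
    using insert.prems by (auto intro: linear_map_on_subset[of _ _ S] simp: K_def)
  moreover have "g x = 0" if "x \<in> K" "\<And>j. j \<in> I \<Longrightarrow> f j x = 0" for x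
    using insert.prems(4)[of x] that by (auto simp: K_def)
  ultimately obtain c where c: "\<forall>x\<in>K. g x = (\<Sum>j\<in>I. c j * f j x)"
    using insert.IH[of K] by blast
  define h where "h x = g x - (\<Sum>j\<in>I. c j * f j x)" for x
  have h_add: "h (x + y) = h x + h y" if "x \<in> S" "y \<in> S" for x y
  proof -
    have "(\<Sum>j\<in>I. c j * f j (x + y)) = (\<Sum>j\<in>I. c j * f j x + c j * f j y)"
      using insert.prems(2) that by (intro sum.cong) (auto simp: linear_map_on_def algebra_simps)
    moreover have "g (x + y) = g x + g y"
      using insert.prems(3) that by (auto simp: linear_map_on_def)
    ultimately show ?thesis by (simp add: h_def sum.distrib)
  qed
  have h_scale: "h (scale a x) = a * h x" if "x \<in> S" for a x
  proof -
    have "(\<Sum>j\<in>I. c j * f j (scale a x)) = (\<Sum>j\<in>I. a * (c j * f j x))"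
      using insert.prems(2) that by (intro sum.cong) (auto simp: linear_map_on_def algebra_simps)
    moreover have "g (scale a x) = a * g x"
      using insert.prems(3) that by (auto simp: linear_map_on_def)
    ultimately show ?thesis by (simp add: h_def sum_distrib_left right_diff_distrib)
  qed
  have h_kernel: "h x = 0" if "x \<in> S" "f i x = 0" for x
    using c that by (simp add: h_def K_def)
  have "\<exists>d. \<forall>x\<in>S. h x = d * f i x"
  proof (cases "\<exists>s\<in>S. f i s \<noteq> 0")
    case False
    then show ?thesis using h_kernel by auto
  next
    case True
    then obtain s where s: "s \<in> S" "f i s \<noteq> 0" by blast
    have "h x = (h s / f i s) * f i x" if x: "x \<in> S" for x
    proof -
      let ?a = "- (f i x / f i s)"
      have as: "scale ?a s \<in> S" using s S by (simp add: subspace_scale del: scale_minus_left)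
      have "f i (x + scale ?a s) = f i x + ?a * f i s"
        using fi x s as unfolding linear_map_on_def by metis
      also have "\<dots> = 0" using s by simp
      finally have "h (x + scale ?a s) = 0"
        using h_kernel x as S by (metis subspace_add)
      then show ?thesis
        using h_add[OF x as] h_scale[OF s(1), of ?a] s(2) by (simp add: field_simps del: scale_minus_left)
    qed
    then show ?thesis by blast
  qed
  then obtain d where d: "\<forall>x\<in>S. h x = d * f i x" by blast
  have "g x = (\<Sum>j\<in>insert i I. (c(i := d)) j * f j x)" if "x \<in> S" for x
  proof -
    have "(\<Sum>j\<in>I. (c(i := d)) j * f j x) = (\<Sum>j\<in>I. c j * f j x)"
      using insert.hyps by (intro sum.cong) auto
    then show ?thesis
      using d that insert.hyps by (simp add: h_def algebra_simps)
  qed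
  then show ?case by blast
qed

lemma finite_dim_subspace:
  assumes "finite F" "U \<subseteq> span F" "subspace U"
  shows "\<exists>X. finite X \<and> span X = U"
proof -
  obtain X where X: "X \<subseteq> U" "independent X" "U \<subseteq> span X" "card X = dim U"
    using basis_exists by blast
  have "X \<subseteq> span F" using X(1) assms(2) by (rule subset_trans)
  then have "finite X" using independent_span_bound[OF assms(1) X(2)] by simp
  moreover have "span X = U" using X(1,3) assms(3) by (rule span_subspace)
  ultimately show ?thesis by blast
qed

lemma quotient_basis_if_codim_one:
  assumes "finite F" "W \<subseteq> span F" "subspace U" "subspace W" "U \<subseteq> W"
    and "dim W = dim U + 1" "a \<in> W" "a \<notin> U"
  shows "quotient_basis W U a"
proof -
  obtain X where X: "X \<subseteq> U" "independent X" "U \<subseteq> span X" "card X = dim U"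
    using basis_exists by blast
  have XU: "span X = U" using X \<open>subspace U\<close> by (metis span_subspace)
  have finX: "finite X"
    using independent_span_bound[of F X] X assms by blast
  have indep: "independent (insert a X)"
    using X XU \<open>a \<notin> U\<close> by (simp add: independent_insertI)
  obtain Y where Y: "insert a X \<subseteq> Y" "Y \<subseteq> W" "independent Y" "W \<subseteq> span Y"
    using maximal_independent_subset_extend[of "insert a X" W] indep X assms by (metis insert_subset subset_trans)
  have finY: "finite Y" using independent_span_bound[of F Y] Y assms by blast
  have "card Y = dim W" using Y by (metis basis_card_eq_dim)
  moreover have "card (insert a X) = dim U + 1"
    using finX X XU \<open>a \<notin> U\<close> span_base by (subst card_insert_disjoint) auto
  ultimately have "insert a X = Y"
    using finY Y assms by (intro card_subset_eq) auto
  then have "\<exists>k. w - scale k a \<in> U" if "w \<in> W" for w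
    using that Y XU span_breakdown_eq[of w a X] by auto
  then show ?thesis using assms by (auto simp: quotient_basis_def)
qed

lemma dim_span_insert:
  assumes "finite F" "U \<subseteq> span F" "subspace U" "a \<notin> U"
  shows "dim (span (insert a U)) = dim U + 1"
proof -
  obtain X where X: "X \<subseteq> U" "independent X" "U \<subseteq> span X" "card X = dim U"
    using basis_exists by blast
  have XU: "span X = U" using X \<open>subspace U\<close> by (metis span_subspace)
  have finX: "finite X"
    using independent_span_bound[of F X] X assms by blast
  have indep: "independent (insert a X)"
    using X XU \<open>a \<notin> U\<close> by (simp add: independent_insertI)
  have "span (insert a U) = span (insert a X)"
    using XU by (metis span_insert span_span)
  moreover have "dim (span (insert a X)) = card (insert a X)"
    using indep by (metis dim_span dim_eq_card_independent)
  ultimately show ?thesis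
    using finX X XU \<open>a \<notin> U\<close> span_base by (subst (asm) card_insert_disjoint) auto
qed

end

section \<open>Calculations in Lie superalgebras\<close>

lemma psign_simps [simp]: "psign 0 = 1" "psign 1 = - 1"
  by (simp_all add: psign_def)

context lie_superalgebra
begin

lemma part_subset_total: "G i \<subseteq> total G"
proof -
  have "G 0 \<subseteq> total G"
    using subspace_0[OF subspace_part[of 1]] unfolding total_def by force
  moreover have "G 1 \<subseteq> total G"
    using subspace_0[OF subspace_part[of 0]] unfolding total_def by force
  ultimately show ?thesis by (cases i) auto
qed

lemmas in_total = subsetD[OF part_subset_total]

lemma total_cases:
  assumes "x \<in> total G"
  obtains a b where "x = a + b" "a \<in> G 0" "b \<in> G 1"
  using assms unfolding total_def by blast

lemma subspace_total: "subspace (total G)"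
  using subspace_sums[OF subspace_part[of 0] subspace_part[of 1]] by (simp add: total_def)

lemma total_add: "x \<in> total G \<Longrightarrow> y \<in> total G \<Longrightarrow> x + y \<in> total G"
  and total_scale: "x \<in> total G \<Longrightarrow> scale c x \<in> total G"
  and total_diff: "x \<in> total G \<Longrightarrow> y \<in> total G \<Longrightarrow> x - y \<in> total G"
  using subspace_total by (auto simp: subspace_add subspace_scale subspace_diff)

lemma br_add_left: "x \<in> total G \<Longrightarrow> x' \<in> total G \<Longrightarrow> y \<in> total G \<Longrightarrow> br (x + x') y = br x y + br x' y"
  and br_add_right: "x \<in> total G \<Longrightarrow> y \<in> total G \<Longrightarrow> y' \<in> total G \<Longrightarrow> br x (y + y') = br x y + br x y'"
  and br_scale_left: "x \<in> total G \<Longrightarrow> y \<in> total G \<Longrightarrow> br (scale c x) y = scale c (br x y)"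
  and br_scale_right: "x \<in> total G \<Longrightarrow> y \<in> total G \<Longrightarrow> br x (scale c y) = scale c (br x y)"
  using br_bilinear unfolding bilinear_map_on_def linear_map_on_def by auto

lemma br_diff_left: "x \<in> total G \<Longrightarrow> x' \<in> total G \<Longrightarrow> y \<in> total G \<Longrightarrow> br (x - x') y = br x y - br x' y"
  using br_add_left[of "x - x'" x' y] total_diff by (auto simp: algebra_simps)

lemma br_diff_right: "x \<in> total G \<Longrightarrow> y \<in> total G \<Longrightarrow> y' \<in> total G \<Longrightarrow> br x (y - y') = br x y - br x y'"
  using br_add_right[of x "y - y'" y'] total_diff by (auto simp: algebra_simps)

lemma br_total:
  assumes "x \<in> total G" "y \<in> total G" shows "br x y \<in> total G"
proof -
  obtain a b where x: "x = a + b" "a \<in> G 0" "b \<in> G 1" using assms(1) by (rule total_cases)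
  obtain c d where y: "y = c + d" "c \<in> G 0" "d \<in> G 1" using assms(2) by (rule total_cases)
  show ?thesis
    using x y by (auto simp: br_add_left br_add_right in_total total_add
        intro!: total_add intro: in_total[OF br_graded])
qed

lemma finite_dim_total: "\<exists>F. finite F \<and> total G \<subseteq> span F"
proof -
  obtain F0 F1 where F: "finite F0" "span F0 = G 0" "finite F1" "span F1 = G 1"
    using finite_dim_part by metis
  have "total G \<subseteq> span (F0 \<union> F1)"
    using F by (auto simp: span_Un total_def)
  then show ?thesis using F by blast
qed

text \<open>
  For odd \<open>x\<close> the Jacobi identity reads \<open>[x, [x, y]] = [[x, x], y] - [x, [x, y]]\<close>, and the last term
  moves to the left.
\<close>

lemma odd_bracket_square:
  assumes "x \<in> G 1" "y \<in> total G"
  shows "br x (br x y) = scale (1 / 2) (br (br x x) y)"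
proof -
  have "br x (br x y) = br (br x x) y - br x (br x y)"
    using super_jacobi[OF assms(1,1,2)] by simp
  then have "br (br x x) y = scale 2 (br x (br x y))"
    using scale_left_distrib[of 1 1 "br x (br x y)"] by (simp add: algebra_simps)
  then show ?thesis by simp
qed

text \<open>
  With \<open>y = x\<close> the preceding identity, together with \<open>[[x, x], x] = - [x, [x, x]]\<close>, says that
  \<open>[x, [x, x]]\<close> is \<open>- 1 / 2\<close> times itself.
\<close>

lemma odd_bracket_cube:
  assumes "x \<in> G 1"
  shows "br x (br x x) = 0"
proof -
  have "br x x \<in> G 0" using br_graded[OF assms assms] by simp
  then have "br (br x x) x = - br x (br x x)"
    using br_super_skew[of "br x x" 0 x 1] assms by simp
  then have "br x (br x x) = scale (1 / 2) (- br x (br x x))"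
    using odd_bracket_square[OF assms in_total[OF assms]] by metis
  then have "scale 1 (br x (br x x)) + scale (1 / 2) (br x (br x x)) = 0"
    by (metis add.left_inverse add.commute scale_minus_right scale_one minus_minus)
  then have "scale (1 + 1 / 2) (br x (br x x)) = 0"
    by (simp only: scale_left_distrib)
  moreover have "1 + 1 / 2 \<noteq> (0::'k)" by (simp add: field_simps)
  ultimately show ?thesis by simp
qed

end

context odd_quadratic_lie_superalgebra
begin

lemma form_add_left: "x \<in> total G \<Longrightarrow> x' \<in> total G \<Longrightarrow> y \<in> total G \<Longrightarrow> B (x + x') y = B x y + B x' y"
  and form_add_right: "x \<in> total G \<Longrightarrow> y \<in> total G \<Longrightarrow> y' \<in> total G \<Longrightarrow> B x (y + y') = B x y + B x y'"
  and form_scale_left: "x \<in> total G \<Longrightarrow> y \<in> total G \<Longrightarrow> B (scale c x) y = c * B x y"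
  and form_scale_right: "x \<in> total G \<Longrightarrow> y \<in> total G \<Longrightarrow> B x (scale c y) = c * B x y"
  using form_bilinear unfolding bilinear_map_on_def linear_map_on_def by auto

lemma form_diff_left: "x \<in> total G \<Longrightarrow> x' \<in> total G \<Longrightarrow> y \<in> total G \<Longrightarrow> B (x - x') y = B x y - B x' y"
  using form_add_left[of "x - x'" x' y] total_diff by (auto simp: algebra_simps)

text \<open>The sign in supersymmetry only appears between two odd vectors, where an odd form vanishes.\<close>

lemma form_symmetric:
  assumes "x \<in> total G" "y \<in> total G" shows "B x y = B y x"
proof -
  obtain a b where x: "x = a + b" "a \<in> G 0" "b \<in> G 1" using assms(1) by (rule total_cases)
  obtain c d where y: "y = c + d" "c \<in> G 0" "d \<in> G 1" using assms(2) by (rule total_cases)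
  have "B a d = B d a" "B b c = B c b"
    using form_supersymmetric[of a 0 d 1] form_supersymmetric[of b 1 c 0] x y by auto
  moreover have "B a c = 0" "B c a = 0" "B b d = 0" "B d b = 0"
    using form_odd x y by metis+
  ultimately show ?thesis
    using x y by (simp add: form_add_left form_add_right in_total total_add)
qed

lemma eq_0_if_orthogonal_to_parts:
  assumes "x \<in> total G" "\<And>y. y \<in> G 0 \<Longrightarrow> B x y = 0" "\<And>y. y \<in> G 1 \<Longrightarrow> B x y = 0"
  shows "x = 0"
proof (rule form_nondegenerate[OF assms(1)])
  fix y assume "y \<in> total G"
  then obtain c d where y: "y = c + d" "c \<in> G 0" "d \<in> G 1" by (rule total_cases)
  then show "B x y = 0"
    using assms by (simp add: form_add_right in_total)
qed

text \<open>By finite dimension, nondegeneracy makes the pairing of the even with the odd part perfect: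
  the functionals \<open>B x\<close>, for \<open>x\<close> in a finite spanning set of the even part, have no common zero
  on the odd part but \<open>0\<close>, so they span its dual.\<close>

lemma odd_functional_represented:
  assumes g: "linear_map_on scale (*) (G 1) g"
  shows "\<exists>u\<in>G 0. \<forall>w\<in>G 1. B u w = g w"
proof -
  obtain F where F: "finite F" "span F = G 0" using finite_dim_part by blast
  have FG: "x \<in> G 0" if "x \<in> F" for x using F that span_base by blast
  have g0: "g 0 = 0"
    using g subspace_0[OF subspace_part[of 1]] unfolding linear_map_on_def
    by (metis mult_zero_left scale_zero_left)
  have "w = 0" if w: "w \<in> G 1" and ortho: "\<And>x. x \<in> F \<Longrightarrow> B x w = 0" for w
  proof (rule eq_0_if_orthogonal_to_parts)
    show "w \<in> total G" using w by (rule in_total)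
    show "B w y = 0" if "y \<in> G 1" for y using form_odd w that by blast
    have "subspace {y \<in> G 0. B y w = 0}"
      using subspace_part[of 0] w
      by (auto simp: subspace_def form_add_left form_scale_left in_total)
         (metis form_scale_left in_total mult_zero_left scale_zero_left w)
    then have "span F \<subseteq> {y \<in> G 0. B y w = 0}"
      using FG ortho by (intro span_minimal) auto
    then show "B w y = 0" if "y \<in> G 0" for y
      using F that w form_symmetric[of w y] by (auto simp: in_total)
  qed
  moreover have "linear_map_on scale (*) (G 1) (B x)" if "x \<in> F" for x
    using FG[OF that] by (simp add: linear_map_on_def form_add_right form_scale_right in_total)
  ultimately obtain c where c: "\<forall>w\<in>G 1. g w = (\<Sum>x\<in>F. c x * B x w)"
    using functional_eq_sum_if_common_kernel[of F "G 1" B g] F g g0 subspace_part by blast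
  have sum_form: "(\<Sum>x\<in>A. scale (c x) x) \<in> G 0 \<and>
      B (\<Sum>x\<in>A. scale (c x) x) w = (\<Sum>x\<in>A. c x * B x w)"
    if "finite A" "A \<subseteq> F" "w \<in> G 1" for A w
    using that
  proof (induction A rule: finite_induct)
    case empty
    have "B 0 w = 0"
      using form_scale_left[of 0 w 0] that(3) in_total subspace_0[OF subspace_total] by simp
    then show ?case using subspace_0[OF subspace_part] by simp
  next
    case (insert x A)
    then have "scale (c x) x \<in> G 0" "x \<in> G 0" using FG subspace_part by (auto intro: subspace_scale)
    then show ?case
      using insert subspace_part[of 0]
      by (auto simp: form_add_left form_scale_left in_total intro: subspace_add)
  qed
  show ?thesis
    using sum_form[OF F(1) order_refl] c subspace_0[OF subspace_part[of 1]] by (metis (no_types, lifting))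
qed

text \<open>Invariance moves a bracket across the form, so the even vectors orthogonal to
  \<open>[\<gg>\<^sub>0, \<gg>\<^sub>1]\<close> are central.\<close>

lemma central_if_orthogonal_to_brackets:
  assumes u: "u \<in> G 0" and ortho: "\<And>x v. x \<in> G 0 \<Longrightarrow> v \<in> G 1 \<Longrightarrow> B u (br x v) = 0"
    and y: "y \<in> total G"
  shows "br u y = 0"
proof -
  have even: "br u x = 0" if x: "x \<in> G 0" for x
  proof (rule eq_0_if_orthogonal_to_parts)
    have "br u x \<in> G 0" using br_graded[OF u x] by simp
    then show "br u x \<in> total G" by (rule in_total)
    show "B (br u x) v = 0" if "v \<in> G 0" for v
      using form_odd \<open>br u x \<in> G 0\<close> that by blast
    show "B (br u x) v = 0" if "v \<in> G 1" for v
      using ortho[OF x that] u x that by (simp add: form_invariant in_total)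
  qed
  have odd: "br u v = 0" if v: "v \<in> G 1" for v
  proof (rule eq_0_if_orthogonal_to_parts)
    have uv: "br u v \<in> G 1" using br_graded[OF u v] by simp
    then show "br u v \<in> total G" by (rule in_total)
    show "B (br u v) w = 0" if "w \<in> G 1" for w using form_odd uv that by blast
    show "B (br u v) x = 0" if x: "x \<in> G 0" for x
    proof -
      have xv: "br x v \<in> total G" using br_total x v in_total by blast
      have "br v x = scale (- 1) (br x v)" using br_super_skew[OF v x] by simp
      then have "B u (br v x) = - 1 * B u (br x v)"
        using form_scale_right[OF in_total[OF u] xv] by metis
      then show ?thesis
        using ortho[OF x v] u x v by (simp add: form_invariant in_total)
    qed
  qed
  obtain a b where "y = a + b" "a \<in> G 0" "b \<in> G 1" using y by (rule total_cases)
  then show ?thesis using even odd u by (simp add: br_add_right in_total)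
qed

end

section \<open>Reduction by a central even vector\<close>

text \<open>
  Here \<open>u\<close> plays the role of \<open>e\<^sup>*\<close>.  Being even, it is isotropic, so the quotient of \<open>u\<^sup>\<bottom>\<close> by the line
  of \<open>u\<close> makes sense.  The space \<open>perp\<close> below represents this quotient inside \<open>\<gg>\<close>, and \<open>proj\<close> moves a
  vector of \<open>u\<^sup>\<bottom>\<close> along \<open>u\<close> to its representative orthogonal to \<open>e\<close>.
\<close>

locale central_odd_pair = odd_quadratic_lie_superalgebra scale G br B
  for scale :: "'k::{alg_closed_field, field_char_0} \<Rightarrow> 'v::ab_group_add \<Rightarrow> 'v"
    and G :: "bit \<Rightarrow> 'v set" and br :: "'v \<Rightarrow> 'v \<Rightarrow> 'v" and B :: "'v \<Rightarrow> 'v \<Rightarrow> 'k" +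
  fixes e u :: 'v
  assumes e_odd: "e \<in> G 1" and u_even: "u \<in> G 0" and pairing: "B e u = 1"
    and central: "x \<in> total G \<Longrightarrow> br u x = 0"
begin

definition proj :: "'v \<Rightarrow> 'v" where "proj w = w - scale (B w e) u"

definition perp :: "bit \<Rightarrow> 'v set" where "perp i = {x \<in> G i. B x e = 0 \<and> B x u = 0}"

definition perp_br :: "'v \<Rightarrow> 'v \<Rightarrow> 'v" where "perp_br x y = proj (br x y)"

definition perp_der :: "'v \<Rightarrow> 'v" where "perp_der x = proj (br e x)"

lemma e_total: "e \<in> total G" and u_total: "u \<in> total G"
  using e_odd u_even by (auto intro: in_total)

lemma form_u_e: "B u e = 1" and form_u_u: "B u u = 0"
  using pairing form_symmetric[OF e_total u_total] form_odd[OF u_even u_even]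
    by auto

lemma central_right:
  assumes "x \<in> total G" shows "br x u = 0"
proof -
  obtain a b where x: "x = a + b" "a \<in> G 0" "b \<in> G 1" using assms by (rule total_cases)
  have "br a u = 0" "br b u = 0"
    using br_super_skew[OF _ u_even] x central by (auto simp: in_total)
  then show ?thesis using x u_total by (simp add: br_add_left in_total)
qed

lemma bracket_perp_u:
  assumes "x \<in> total G" "y \<in> total G" shows "B (br x y) u = 0"
proof -
  have "B (br x y) u = B x (br y u)" using assms u_total by (simp add: form_invariant)
  also have "\<dots> = B x (scale 0 u)" using central_right assms by simp
  also have "\<dots> = 0" using form_scale_right[OF assms(1) u_total, of 0] by simp
  finally show ?thesis .
qed

lemma proj_total: "w \<in> total G \<Longrightarrow> proj w \<in> total G"
  using u_total by (simp add: proj_def total_diff total_scale)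

lemma proj_add: "v \<in> total G \<Longrightarrow> w \<in> total G \<Longrightarrow> proj (v + w) = proj v + proj w"
  using e_total by (simp add: proj_def form_add_left scale_left_distrib)

lemma proj_scale: "w \<in> total G \<Longrightarrow> proj (scale c w) = scale c (proj w)"
  using e_total by (simp add: proj_def form_scale_left scale_right_diff_distrib)

lemma proj_minus: "w \<in> total G \<Longrightarrow> proj (- w) = - proj w"
  using proj_scale[of w "- 1"] by simp

lemma proj_odd: "w \<in> G 1 \<Longrightarrow> proj w = w"
  using form_odd[OF _ e_odd] by (simp add: proj_def)

lemma proj_decomp: "w = proj w + scale (B w e) u"
  by (simp add: proj_def)

lemma br_proj_left: "w \<in> total G \<Longrightarrow> x \<in> total G \<Longrightarrow> br (proj w) x = br w x"
  using u_total by (simp add: proj_def br_diff_left br_scale_left total_scale central)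

lemma br_proj_right: "w \<in> total G \<Longrightarrow> x \<in> total G \<Longrightarrow> br x (proj w) = br x w"
  using u_total by (simp add: proj_def br_diff_right br_scale_right total_scale central_right)

lemma perp_part: "x \<in> perp i \<Longrightarrow> x \<in> G i"
  by (simp add: perp_def)

lemma perp_in_total: "x \<in> perp i \<Longrightarrow> x \<in> total G"
  by (rule in_total[OF perp_part])

lemma subspace_perp: "subspace (perp i)"
proof -
  have "B 0 e = 0" "B 0 u = 0"
    using form_scale_left[OF u_total e_total, of 0] form_scale_left[OF u_total u_total, of 0] by auto
  then show ?thesis
    using subspace_part[of i] e_total u_total
    by (auto simp: perp_def subspace_def form_add_left form_scale_left in_total)
qed

text \<open>A homogeneous vector is automatically orthogonal to one of \<open>e\<close> and \<open>u\<close>, so the two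
  conditions split over the parities.\<close>

lemma total_perp: "total perp = {x \<in> total G. B x e = 0 \<and> B x u = 0}" (is "_ = ?R")
proof
  show "total perp \<subseteq> ?R"
    using e_total u_total
    by (auto simp: total_def[of perp] perp_def form_add_left in_total total_add)
  show "?R \<subseteq> total perp"
  proof
    fix x assume x: "x \<in> ?R"
    then obtain a b where ab: "x = a + b" "a \<in> G 0" "b \<in> G 1" using total_cases[of x] by auto
    have "B a u = 0" "B b e = 0" using ab form_odd e_odd u_even by blast+
    then have "a \<in> perp 0" "b \<in> perp 1"
      using x ab e_total u_total by (auto simp: perp_def form_add_left in_total)
    then show "x \<in> total perp" using ab by (auto simp: total_def)
  qed
qed

lemma total_perpD: "x \<in> total perp \<Longrightarrow> x \<in> total G"
  by (simp add: total_perp)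

lemma proj_in_perp:
  assumes "w \<in> G i" "B w u = 0" shows "proj w \<in> perp i"
proof -
  have "proj w \<in> G i"
  proof (cases "i = 0")
    case True
    then show ?thesis
      using assms u_even subspace_part[of 0] by (auto simp: proj_def intro: subspace_diff subspace_scale)
  next
    case False
    then show ?thesis using assms proj_odd by simp
  qed
  moreover have "B (proj w) e = 0" "B (proj w) u = 0"
    using assms e_total u_total
    by (auto simp: proj_def form_diff_left form_scale_left total_scale in_total form_u_e form_u_u)
  ultimately show ?thesis by (simp add: perp_def)
qed

lemma form_proj_left:
  assumes "w \<in> total G" "x \<in> total perp" shows "B (proj w) x = B w x"
proof -
  have "B u x = 0" using assms form_symmetric u_total by (auto simp: total_perp)
  then show ?thesis
    using assms u_total by (simp add: proj_def form_diff_left form_scale_left total_scale total_perp)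
qed

lemma form_proj_right:
  assumes "w \<in> total G" "x \<in> total perp" shows "B x (proj w) = B x w"
  using form_proj_left[OF assms] form_symmetric assms proj_total total_perpD by metis

lemma even_decomposition: "G 0 = {x + scale c u |x c. x \<in> perp 0}"
proof
  show "{x + scale c u |x c. x \<in> perp 0} \<subseteq> G 0"
    using u_even subspace_part[of 0] by (auto simp: perp_def intro: subspace_add subspace_scale)
  show "G 0 \<subseteq> {x + scale c u |x c. x \<in> perp 0}"
  proof
    fix x assume x: "x \<in> G 0"
    then have "proj x \<in> perp 0" using proj_in_perp form_odd[OF _ u_even] by blast
    then show "x \<in> {x + scale c u |x c. x \<in> perp 0}" using proj_decomp[of x] by blast
  qed
qed

lemma odd_decomposition: "G 1 = {scale c e + x |c x. x \<in> perp 1}"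
proof
  show "{scale c e + x |c x. x \<in> perp 1} \<subseteq> G 1"
    using e_odd subspace_part[of 1] by (auto simp: perp_def intro: subspace_add subspace_scale)
  show "G 1 \<subseteq> {scale c e + x |c x. x \<in> perp 1}"
  proof
    fix x assume x: "x \<in> G 1"
    let ?y = "x - scale (B x u) e"
    have y: "?y \<in> G 1" using x e_odd subspace_part[of 1] by (auto intro: subspace_diff subspace_scale)
    have "B ?y u = 0"
      using x e_total u_total pairing
      by (simp add: form_diff_left form_scale_left total_scale in_total)
    then have "?y \<in> perp 1" using y form_odd[OF y e_odd] by (simp add: perp_def)
    moreover have "x = scale (B x u) e + ?y" by simp
    ultimately show "x \<in> {scale c e + x |c x. x \<in> perp 1}" by blast
  qed
qed

lemma u_notin_perp: "u \<notin> perp 0" and e_notin_perp: "e \<notin> perp 1"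
  using form_u_e pairing by (auto simp: perp_def)

lemma total_decomposition: "total G = span (insert e (span (insert u (total perp))))"
proof
  have "span (insert u (total perp)) \<subseteq> total G"
    using u_total total_perpD subspace_total by (intro span_minimal) auto
  then show "span (insert e (span (insert u (total perp)))) \<subseteq> total G"
    using e_total subspace_total by (intro span_minimal) auto
  show "total G \<subseteq> span (insert e (span (insert u (total perp))))"
  proof
    fix x assume "x \<in> total G"
    then obtain a b where x: "x = a + b" "a \<in> G 0" "b \<in> G 1" by (rule total_cases)
    obtain a' c where a: "a = a' + scale c u" "a' \<in> perp 0"
      using x even_decomposition by blast
    obtain b' d where b: "b = scale d e + b'" "b' \<in> perp 1"
      using x odd_decomposition by blast
    have "x - scale d e = (a' + b') + scale c u" using x a b by (simp add: algebra_simps)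
    moreover have "a' + b' \<in> total perp" using a b by (auto simp: total_def)
    ultimately have "x - scale d e \<in> span (insert u (total perp))"
      by (metis insertI1 insertI2 span_add span_base span_scale)
    then show "x \<in> span (insert e (span (insert u (total perp))))"
      using span_breakdown_eq[of x e "span (insert u (total perp))"] by (auto simp: span_span)
  qed
qed

lemma eq_0_if_orthogonal_to_perp:
  assumes x: "x \<in> total perp" and ortho: "\<And>y. y \<in> total perp \<Longrightarrow> B x y = 0"
  shows "x = 0"
proof (rule eq_0_if_orthogonal_to_parts)
  show xG: "x \<in> total G" using x by (rule total_perpD)
  have perp_total: "y \<in> total perp" if "y \<in> perp i" for y i
    using that in_total[of y i] by (simp add: perp_def total_perp)
  have xe: "B x e = 0" "B x u = 0" using x by (auto simp: total_perp)
  show "B x y = 0" if "y \<in> G 0" for y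
    using that even_decomposition ortho xe xG u_total perp_total total_perpD
    by (auto simp: form_add_right form_scale_right total_scale)
  show "B x y = 0" if "y \<in> G 1" for y
    using that odd_decomposition ortho xe xG e_total perp_total total_perpD
    by (auto simp: form_add_right form_scale_right total_scale)
qed

lemma perp_bilinear: "bilinear_map_on scale scale (total perp) perp_br"
  unfolding bilinear_map_on_def linear_map_on_def perp_br_def
  by (auto simp: total_perpD br_add_left br_add_right br_scale_left br_scale_right
      proj_add proj_scale br_total)

lemma perp_br_graded:
  assumes "x \<in> perp i" "y \<in> perp j" shows "perp_br x y \<in> perp (i + j)"
  unfolding perp_br_def
  by (rule proj_in_perp[OF br_graded[OF perp_part[OF assms(1)] perp_part[OF assms(2)]]
      bracket_perp_u[OF perp_in_total[OF assms(1)] perp_in_total[OF assms(2)]]])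

lemma perp_jacobi:
  assumes "x \<in> perp i" "y \<in> perp j" "z \<in> total perp"
  shows "perp_br x (perp_br y z) =
    perp_br (perp_br x y) z + scale (psign (i * j)) (perp_br y (perp_br x z))"
proof -
  have xyz: "x \<in> total G" "y \<in> total G" "z \<in> total G"
    using assms by (auto simp: perp_in_total total_perpD)
  have "proj (br x (br y z)) = proj (br (br x y) z + scale (psign (i * j)) (br y (br x z)))"
    using super_jacobi[of x i y j z] assms xyz by (simp add: perp_part)
  then show ?thesis
    using xyz by (simp add: perp_br_def br_proj_left br_proj_right br_total proj_add proj_scale total_scale)
qed

text \<open>
  Each axiom is the projection of the corresponding one for \<open>\<gg>\<close>: inside a bracket \<open>proj\<close> can be
  dropped since \<open>u\<close> is central, and inside the form since \<open>u\<close> is orthogonal to \<open>perp\<close>.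
\<close>

theorem perp_odd_quadratic: "odd_quadratic_lie_superalgebra scale perp perp_br B"
proof (unfold_locales)
  obtain F where F: "finite F" "total G \<subseteq> span F" using finite_dim_total by blast
  show "subspace (perp i)" for i by (rule subspace_perp)
  show "\<exists>S. finite S \<and> span S = perp i" for i
  proof (rule finite_dim_subspace[OF F(1)])
    show "perp i \<subseteq> span F" using F(2) perp_in_total by auto
  qed (rule subspace_perp)
  show "perp 0 \<inter> perp 1 = {0}"
    using direct_sum subspace_0[OF subspace_perp[of 0]] subspace_0[OF subspace_perp[of 1]]
      perp_part[of _ 0] perp_part[of _ 1] by auto
  show "bilinear_map_on scale scale (total perp) perp_br" by (rule perp_bilinear)
  show "perp_br x y \<in> perp (i + j)" if "x \<in> perp i" "y \<in> perp j" for x y i j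
    using that by (rule perp_br_graded)
  show "perp_br x y = - scale (psign (i * j)) (perp_br y x)" if "x \<in> perp i" "y \<in> perp j" for x y i j
    using that br_super_skew[of x i y j]
    by (simp add: perp_br_def perp_part perp_in_total br_total total_scale proj_minus proj_scale)
  show "perp_br x (perp_br y z) =
    perp_br (perp_br x y) z + scale (psign (i * j)) (perp_br y (perp_br x z))"
    if "x \<in> perp i" "y \<in> perp j" "z \<in> total perp" for x y z i j
    using that by (rule perp_jacobi)
  show "bilinear_map_on scale (*) (total perp) B"
    using form_bilinear by (rule bilinear_map_on_subset) (auto simp: total_perpD)
  show "B x y = psign (i * j) * B y x" if "x \<in> perp i" "y \<in> perp j" for x y i j
    using that form_supersymmetric perp_part by blast
  show "B (perp_br x y) z = B x (perp_br y z)"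
    if "x \<in> total perp" "y \<in> total perp" "z \<in> total perp" for x y z
    using that by (simp add: perp_br_def form_proj_left form_proj_right br_total total_perpD form_invariant)
  show "B x y = 0" if "x \<in> perp i" "y \<in> perp i" for x y i
    using that form_odd perp_part by blast
  show "x = 0" if "x \<in> total perp" "\<And>y. y \<in> total perp \<Longrightarrow> B x y = 0" for x
    using that by (rule eq_0_if_orthogonal_to_perp)
qed

sublocale perp: odd_quadratic_lie_superalgebra scale perp perp_br B
  by (rule perp_odd_quadratic)

text \<open>
  Adjoin \<open>u\<close> first: the result lies in \<open>u\<^sup>\<bottom>\<close>, hence does not contain \<open>e\<close>.
\<close>

lemma dim_total: "dim (total G) = dim (total perp) + 2"
proof -
  obtain F where F: "finite F" "total G \<subseteq> span F" using finite_dim_total by blast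
  have "u \<notin> total perp" by (auto simp: total_perp form_u_e)
  moreover have "total perp \<subseteq> span F" using F total_perpD by blast
  ultimately have 1: "dim (span (insert u (total perp))) = dim (total perp) + 1"
    using dim_span_insert[OF F(1) _ perp.subspace_total] by blast
  have "span (insert u (total perp)) \<subseteq> {x \<in> total G. B x u = 0}"
    using u_total form_u_u subspace_total form_scale_left[OF u_total u_total, of 0]
    by (intro span_minimal)
       (auto simp: total_perp subspace_def form_add_left form_scale_left)
  then have "e \<notin> span (insert u (total perp))" "span (insert u (total perp)) \<subseteq> span F"
    using pairing F by auto
  then show ?thesis
    using dim_span_insert[OF F(1) _ subspace_span] 1 total_decomposition by simp
qed

lemma perp_der_graded:
  assumes x: "x \<in> perp i" shows "perp_der x \<in> perp (i + 1)"
  unfolding perp_der_def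
  using proj_in_perp[OF br_graded[OF e_odd perp_part[OF x]] bracket_perp_u[OF e_total perp_in_total[OF x]]]
  by (simp add: add.commute)

lemma perp_der_superderivation: "perp.odd_skew_superderivation perp_der"
  unfolding perp.odd_skew_superderivation_def
proof (intro conjI allI ballI)
  show "linear_map_on scale scale (total perp) perp_der"
    using e_total
    by (auto simp: linear_map_on_def perp_der_def total_perpD br_add_right br_scale_right
        proj_add proj_scale br_total)
  fix i x assume x: "x \<in> perp i"
  then have xG: "x \<in> total G" by (rule perp_in_total)
  show "perp_der x \<in> perp (i + 1)" using x by (rule perp_der_graded)
  fix y assume y: "y \<in> total perp"
  then have yG: "y \<in> total G" by (rule total_perpD)
  have sgn: "psign (1 * i) = (psign i :: 'k)" by simp
  have "br e (br x y) = br (br e x) y + scale (psign i) (br x (br e y))"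
    using super_jacobi[OF e_odd perp_part[OF x] yG] sgn by simp
  then have "proj (br e (br x y)) = proj (br (br e x) y + scale (psign i) (br x (br e y)))"
    by simp
  then show "perp_der (perp_br x y) = perp_br (perp_der x) y + scale (psign i) (perp_br x (perp_der y))"
    using xG yG e_total
    by (simp add: perp_br_def perp_der_def br_proj_left br_proj_right br_total proj_add proj_scale total_scale)
  have "br e x = scale (- psign i) (br x e)"
    using br_super_skew[OF e_odd perp_part[OF x]] sgn by simp
  then have "B (br e x) y = - psign i * B (br x e) y"
    using form_scale_left[of "br x e" y "- psign i"] xG yG e_total by (metis br_total)
  also have "B (br x e) y = B x (br e y)"
    using xG yG e_total by (simp add: form_invariant)
  finally show "B (perp_der x) y = - psign i * B x (perp_der y)"
    using x xG y yG e_total perp.in_total[OF x]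
    by (simp add: perp_der_def form_proj_left form_proj_right br_total)
qed

text \<open>
  The coefficient of \<open>u\<close> in \<open>[e, x]\<close> is \<open>B [e, x] e\<close>.  For odd \<open>x\<close> it equals \<open>B x [e, e]\<close> by
  invariance; for even \<open>x\<close> both sides vanish because the form is odd.
\<close>

lemma bracket_e_perp:
  assumes x: "x \<in> perp i"
  shows "br e x = perp_der x - scale (psign i * B x (proj (br e e))) u"
proof -
  have xG: "x \<in> total G" and xp: "x \<in> total perp" using x by (auto simp: perp_in_total perp.in_total)
  have ee: "br e e \<in> G 0" using br_graded[OF e_odd e_odd] by simp
  have "B (br e x) e = - (psign i * B x (proj (br e e)))"
  proof (cases "i = 0")
    case True
    then have "br e x \<in> G 1" using br_graded[OF e_odd perp_part[OF x]] by simp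
    then have "B (br e x) e = 0" using form_odd e_odd by blast
    moreover have "B x (br e e) = 0" using True form_odd[OF _ ee] perp_part[OF x] by blast
    ultimately show ?thesis using xp e_total by (simp add: form_proj_right br_total)
  next
    case False
    then have "br e x = br x e" using br_super_skew[OF e_odd perp_part[OF x]] by simp
    then have "B (br e x) e = B x (br e e)" using xG e_total by (simp add: form_invariant)
    then show ?thesis using False xp e_total by (simp add: form_proj_right br_total)
  qed
  then show ?thesis using proj_decomp[of "br e x"] by (simp add: perp_der_def)
qed

text \<open>
  The two Jacobi identities for \<open>[e, e]\<close> give the conditions on \<open>D X\<^sub>0\<close> and \<open>D\<^sup>2\<close>.  The cocycle in
  \<open>[x, y]\<close> comes from moving \<open>e\<close> across the form: \<open>B [x, y] e = B [e, x] y\<close>.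
\<close>

theorem is_generalized_odd_double_extension:
  assumes flag: "\<And>n V. perp.weak_filiform n V \<Longrightarrow> n \<ge> 3 \<Longrightarrow>
      \<exists>en. quotient_basis (V n) (V (n - 1)) en \<and> en \<in> perp_der ` perp 0"
  shows "generalized_odd_double_extension scale G br B perp perp_br B perp_der
    (proj (br e e)) (B (br e e) e) e u"
proof (unfold_locales)
  have ee: "br e e \<in> G 0" using br_graded[OF e_odd e_odd] by simp
  show "perp.odd_skew_superderivation perp_der" by (rule perp_der_superderivation)
  show "proj (br e e) \<in> perp 0"
    using ee e_total by (intro proj_in_perp bracket_perp_u)
  show "perp_der (proj (br e e)) = 0"
    using e_total odd_bracket_cube[OF e_odd] proj_scale[OF u_total, of 0]
    by (simp add: perp_der_def br_proj_right br_total)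
  show "perp_der (perp_der x) = scale (1 / 2) (perp_br (proj (br e e)) x)" if "x \<in> total perp" for x
    using odd_bracket_square[OF e_odd, of x] that e_total
    by (simp add: perp_der_def perp_br_def br_proj_right br_proj_left br_total proj_scale total_perpD)
  show "\<exists>en. quotient_basis (V n) (V (n - 1)) en \<and> en \<in> perp_der ` perp 0"
    if "perp.weak_filiform n V" "n \<ge> 3" for n V
    using flag that .
  show "G 0 = {x + scale c u |x c. x \<in> perp 0}" "u \<notin> perp 0"
    by (rule even_decomposition u_notin_perp)+
  show "G 1 = {scale c e + x |c x. x \<in> perp 1}" "e \<notin> perp 1"
    by (rule odd_decomposition e_notin_perp)+
  show "br e e = proj (br e e) + scale (B (br e e) e) u" by (rule proj_decomp)
  show "br e x = perp_der x - scale (psign i * B x (proj (br e e))) u" if "x \<in> perp i" for x i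
    using that by (rule bracket_e_perp)
  show "br x y = perp_br x y + scale (B (perp_der x) y) u" if xy: "x \<in> total perp" "y \<in> total perp" for x y
  proof -
    have G: "x \<in> total G" "y \<in> total G" using xy by (auto simp: total_perpD)
    have "B (perp_der x) y = B (br e x) y"
      using xy G e_total by (simp add: perp_der_def form_proj_left br_total)
    also have "\<dots> = B e (br x y)"
      using G e_total by (simp add: form_invariant)
    also have "\<dots> = B (br x y) e"
      using form_symmetric[OF e_total br_total[OF G]] .
    finally show ?thesis using proj_decomp[of "br x y"] by (simp add: perp_br_def)
  qed
  show "br u x = 0" if "x \<in> total G" for x using that by (rule central)
  show "B e u = 1" by (rule pairing)
  show "B x e = 0" "B x u = 0" if "x \<in> total perp" for x using that by (auto simp: total_perp)
qed auto

end

section \<open>Weak filiform odd parts\<close>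

context lie_superalgebra
begin

lemma weak_filiform_bracket_span:
  "weak_filiform m V \<Longrightarrow> 2 \<le> i \<Longrightarrow> i \<le> m \<Longrightarrow> span {br x v |x v. x \<in> G 0 \<and> v \<in> V i} = V (i - 1)"
  by (simp add: weak_filiform_def)

lemma weak_filiform_step:
  assumes "weak_filiform m V" "2 \<le> i" "i \<le> m"
  shows "V (i - 1) \<subset> V i" and "dim (V i) = i"
  using assms by (auto simp: weak_filiform_def)

lemma weak_filiform_subspace:
  assumes "weak_filiform m V" "1 \<le> i" "i \<le> m" shows "subspace (V i)"
proof (cases "i = 1")
  case True
  then show ?thesis using assms by (simp add: weak_filiform_def)
next
  case False
  then show ?thesis using assms by (simp add: weak_filiform_def)
qed

end

text \<open>The functional on the odd part that reads off the coefficient of \<open>e\<close> modulo \<open>V (m - 1)\<close> is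
  represented by an even \<open>u\<close>.  As \<open>V (m - 1)\<close> is spanned by brackets, \<open>u\<close> is central.\<close>

lemma (in odd_quadratic_lie_superalgebra) weak_filiform_central_odd_pair:
  assumes wf: "weak_filiform m V" and m: "m \<ge> 2" and e: "quotient_basis (V m) (V (m - 1)) e"
  obtains u where "central_odd_pair scale G br B e u" "V (m - 1) = {v \<in> G 1. B v u = 0}"
proof -
  let ?U = "V (m - 1)"
  have Vm: "V m = G 1" using wf by (simp add: weak_filiform_def)
  have U: "subspace ?U" using weak_filiform_subspace[OF wf] m by simp
  have UG: "?U \<subseteq> G 1" using wf m Vm by (force simp: weak_filiform_def)
  have eG: "e \<in> G 1" "e \<notin> ?U" using e Vm by (auto simp: quotient_basis_def)
  define g where "g w = (SOME c. w - scale c e \<in> ?U)" for w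
  have g: "w - scale (g w) e \<in> ?U" if "w \<in> G 1" for w
    using that e Vm unfolding g_def quotient_basis_def by (metis someI_ex)
  have g_unique: "g w = c" if "w \<in> G 1" "w - scale c e \<in> ?U" for w c
  proof (rule ccontr)
    assume ne: "g w \<noteq> c"
    have "(w - scale c e) - (w - scale (g w) e) \<in> ?U"
      by (rule subspace_diff[OF U that(2) g[OF that(1)]])
    then have "scale (g w - c) e \<in> ?U" by (simp add: algebra_simps)
    then have "scale (1 / (g w - c)) (scale (g w - c) e) \<in> ?U" by (rule subspace_scale[OF U])
    then show False using ne eG by simp
  qed
  have "linear_map_on scale (*) (G 1) g"
    unfolding linear_map_on_def
  proof (intro conjI ballI allI)
    fix x assume x: "x \<in> G 1"
    have "scale c x - scale (c * g x) e = scale c (x - scale (g x) e)" for c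
      by (simp add: scale_right_diff_distrib)
    then show "g (scale c x) = c * g x" for c
      using g[OF x] x U subspace_part[of 1] by (intro g_unique) (auto intro: subspace_scale)
    fix y assume y: "y \<in> G 1"
    have eq: "x + y - scale (g x + g y) e = (x - scale (g x) e) + (y - scale (g y) e)"
      by (simp add: scale_left_distrib)
    show "g (x + y) = g x + g y"
    proof (rule g_unique)
      show "x + y \<in> G 1" using x y subspace_part by (simp add: subspace_add)
      show "x + y - scale (g x + g y) e \<in> ?U"
        unfolding eq by (rule subspace_add[OF U g[OF x] g[OF y]])
    qed
  qed
  then obtain u where u: "u \<in> G 0" "\<And>w. w \<in> G 1 \<Longrightarrow> B u w = g w"
    using odd_functional_represented by metis
  have gU: "g w = 0 \<longleftrightarrow> w \<in> ?U" if "w \<in> G 1" for w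
    using g[OF that] g_unique[OF that, of 0] by auto
  have "B u (br x v) = 0" if x: "x \<in> G 0" and v: "v \<in> G 1" for x v
  proof -
    have "br x v \<in> ?U"
      using weak_filiform_bracket_span[OF wf m order_refl] x v Vm by (auto intro: span_base)
    then show ?thesis using gU u UG by auto
  qed
  then have central: "br u x = 0" if "x \<in> total G" for x
    using central_if_orthogonal_to_brackets u that by blast
  have "g e = 1" using g_unique[OF eG(1), of 1] subspace_0[OF U] by simp
  then have "B e u = 1" using u eG form_symmetric[of e u] by (simp add: in_total)
  then have "central_odd_pair scale G br B e u"
    using eG u central by unfold_locales auto
  moreover have "V (m - 1) = {v \<in> G 1. B v u = 0}"
    using gU u UG form_symmetric[OF in_total[OF u(1)]] by (auto simp: in_total)
  ultimately show ?thesis using that by blast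
qed

context central_odd_pair
begin

text \<open>Even vectors of \<open>\<gg>\<close> and of \<open>perp\<close> differ by multiples of the central \<open>u\<close>, and projecting
  does not change odd brackets; so the spans that define the flag are the same.\<close>

lemma perp_bracket_set:
  assumes "W \<subseteq> perp 1"
  shows "{perp_br x v |x v. x \<in> perp 0 \<and> v \<in> W} = {br x v |x v. x \<in> G 0 \<and> v \<in> W}"
proof -
  have eq: "perp_br (proj x) v = br x v" if "x \<in> G 0" "v \<in> W" for x v
  proof -
    have v: "v \<in> G 1" using that assms perp_part by blast
    have "br x v \<in> G 1" using br_graded[OF that(1) v] by simp
    then show ?thesis
      using that v by (simp add: perp_br_def br_proj_left in_total proj_odd)
  qed
  have pr: "proj x \<in> perp 0" if "x \<in> G 0" for x
    using that form_odd[OF _ u_even] by (intro proj_in_perp)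
  have id: "proj x = x" if "x \<in> perp 0" for x using that by (simp add: perp_def proj_def)
  show ?thesis
  proof
    show "{perp_br x v |x v. x \<in> perp 0 \<and> v \<in> W} \<subseteq> {br x v |x v. x \<in> G 0 \<and> v \<in> W}"
      using eq id perp_part by (smt (verit) Collect_mono)
    show "{br x v |x v. x \<in> G 0 \<and> v \<in> W} \<subseteq> {perp_br x v |x v. x \<in> perp 0 \<and> v \<in> W}"
      using eq pr by (smt (verit) Collect_mono)
  qed
qed

lemma perp_weak_filiform:
  assumes wf: "weak_filiform m V" and m: "m \<ge> 3" and V: "V (m - 1) = perp 1"
  shows "perp.weak_filiform (m - 1) V"
proof -
  have mono: "V i \<subseteq> perp 1" if "i \<in> {2..m - 1}" for i
  proof -
    have "V i \<subseteq> V j" if "i \<le> j" "j \<le> m - 1" for j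
      using that
    proof (induction j rule: dec_induct)
      case (step j)
      have "V j \<subset> V (Suc j)"
        using weak_filiform_step(1)[OF wf, of "Suc j"] step \<open>i \<in> _\<close> by simp
      then show ?case using step by auto
    qed simp
    then show ?thesis using that V by auto
  qed
  show ?thesis
    unfolding perp.weak_filiform_def
  proof (intro conjI ballI)
    show "0 < m - 1" using m by simp
    show "dim (perp 1) = m - 1" "V 1 = {0}"
      using wf m V[symmetric] by (auto simp: weak_filiform_def)
    show "V (m - 1) = perp 1" by (rule V)
    fix i assume i: "i \<in> {2..m - 1}"
    then have i': "i \<in> {2..m}" by auto
    show "subspace (V i)" "dim (V i) = i" "V (i - 1) \<subset> V i"
      using wf i' by (auto simp: weak_filiform_def)
    show "span {perp_br x v |x v. x \<in> perp 0 \<and> v \<in> V i} = V (i - 1)"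
      using wf i' by (simp add: perp_bracket_set[OF mono[OF i]] weak_filiform_def)
  qed
qed

text \<open>If \<open>[e, \<cdot>]\<close> mapped the even part into \<open>V (m - 2)\<close>, then \<open>V (m - 1) = [\<gg>\<^sub>0, \<gg>\<^sub>1]\<close> would collapse
  to \<open>V (m - 2)\<close>, because \<open>\<gg>\<^sub>1\<close> is spanned by \<open>e\<close> and \<open>V (m - 1)\<close>.\<close>

lemma perp_der_reaches_flag_top:
  assumes wf: "weak_filiform m V" and m: "m \<ge> 3" and V: "V (m - 1) = perp 1"
  shows "\<exists>y \<in> perp_der ` perp 0. y \<notin> V (m - 2)"
proof (rule ccontr)
  assume "\<not> ?thesis"
  then have D: "perp_der x \<in> V (m - 2)" if "x \<in> perp 0" for x using that by blast
  have sub: "subspace (V (m - 2))" using weak_filiform_subspace[OF wf, of "m - 2"] m by simp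
  have Vm: "V m = G 1" using wf by (simp add: weak_filiform_def)
  have idx: "m - Suc (Suc 0) = m - 2" by simp
  have "br x v \<in> V (m - 2)" if x: "x \<in> G 0" and v: "v \<in> G 1" for x v
  proof -
    obtain c w where w: "v = scale c e + w" "w \<in> perp 1" using v odd_decomposition by blast
    have wG: "w \<in> total G" using w by (simp add: perp_in_total)
    have xG: "x \<in> total G" using x by (rule in_total)
    have "span {br x v |x v. x \<in> G 0 \<and> v \<in> perp 1} = V (m - 2)"
      using weak_filiform_bracket_span[OF wf, of "m - 1"] m V by (simp add: idx)
    then have "br x w \<in> V (m - 2)"
      using x w span_base[of "br x w" "{br x v |x v. x \<in> G 0 \<and> v \<in> perp 1}"] by blast
    moreover have "br x e \<in> V (m - 2)"
    proof -
      have "proj x \<in> perp 0" using x form_odd[OF _ u_even] by (intro proj_in_perp)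
      moreover have "br e x \<in> G 1" using br_graded[OF e_odd x] by simp
      ultimately have "br e x \<in> V (m - 2)"
        using D[of "proj x"] xG e_total by (simp add: perp_der_def br_proj_right proj_odd)
      moreover have "br x e = - br e x" using br_super_skew[OF x e_odd] by simp
      ultimately show ?thesis using sub by (simp add: subspace_neg)
    qed
    moreover have "br x v = scale c (br x e) + br x w"
      using w xG wG e_total by (simp add: br_add_right br_scale_right total_scale)
    ultimately show ?thesis using sub by (simp add: subspace_add subspace_scale)
  qed
  then have "span {br x v |x v. x \<in> G 0 \<and> v \<in> V m} \<subseteq> V (m - 2)"
    using sub Vm by (intro span_minimal) auto
  moreover have "V (m - 2) \<subset> V (m - 1)"
    using weak_filiform_step(1)[OF wf, of "m - 1"] m by (simp add: idx)
  ultimately show False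
    using weak_filiform_bracket_span[OF wf, of m] m by auto
qed

text \<open>
  A weak filiform flag is determined in its top two steps by the module, so any flag of \<open>perp\<close>
  agrees there with \<open>V\<close>.
\<close>

lemma perp_flag_top:
  assumes wf: "weak_filiform m V" and m: "m \<ge> 3" and V: "V (m - 1) = perp 1"
    and wf': "perp.weak_filiform n V'" and n: "n \<ge> 3"
  shows "\<exists>en. quotient_basis (V' n) (V' (n - 1)) en \<and> en \<in> perp_der ` perp 0"
proof -
  note wfp = perp_weak_filiform[OF wf m V]
  have nm: "n = m - 1" using wfp wf' by (simp add: perp.weak_filiform_def)
  have top: "V' n = perp 1" using wf' by (simp add: perp.weak_filiform_def)
  have next_eq: "V' (n - 1) = V (n - 1)"
    using perp.weak_filiform_bracket_span[OF wf', of n]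
      perp.weak_filiform_bracket_span[OF wfp, of n] n nm top V by simp
  obtain y where y: "y \<in> perp_der ` perp 0" "y \<notin> V (m - 2)"
    using perp_der_reaches_flag_top[OF wf m V] by blast
  obtain F where F: "finite F" "total perp \<subseteq> span F" using perp.finite_dim_total by blast
  have "quotient_basis (V' n) (V' (n - 1)) y"
  proof (rule quotient_basis_if_codim_one[OF F(1)])
    show "V' n \<subseteq> span F" using F top perp.part_subset_total by blast
    show "subspace (V' (n - 1))" "subspace (V' n)"
      using perp.weak_filiform_subspace[OF wf'] n by auto
    show "V' (n - 1) \<subseteq> V' n" "dim (V' n) = dim (V' (n - 1)) + 1"
      using perp.weak_filiform_step[OF wf', of n] perp.weak_filiform_step(2)[OF wf', of "n - 1"] n
      by auto
    show "y \<in> V' n" using y perp_der_graded[of _ 0] top by auto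
    show "y \<notin> V' (n - 1)" using y next_eq nm by (simp add: numeral_2_eq_2)
  qed
  then show ?thesis using y by blast
qed

end

theorem theorem4p1:
  fixes scale :: "'k::{alg_closed_field, field_char_0} \<Rightarrow> 'v::ab_group_add \<Rightarrow> 'v"
    and G :: "bit \<Rightarrow> 'v set" and br :: "'v \<Rightarrow> 'v \<Rightarrow> 'v" and B :: "'v \<Rightarrow> 'v \<Rightarrow> 'k"
    and m :: nat and V :: "nat \<Rightarrow> 'v set" and em :: 'v
  assumes "odd_quadratic_lie_superalgebra scale G br B"
    and "vector_space.dim scale (G 1) = m" and "m \<ge> 3"
    and "vector_space.dim scale (total G) > 1"
    and "lie_superalgebra.weak_filiform scale G br m V"
    and "vector_space.quotient_basis scale (V m) (V (m - 1)) em"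
  shows "\<exists>H brH BH D X0 lam e'.
    odd_quadratic_lie_superalgebra scale H brH BH \<and>
    vector_space.dim scale (total H) + 2 = vector_space.dim scale (total G) \<and>
    generalized_odd_double_extension scale G br B H brH BH D X0 lam em e' \<and>
    lie_superalgebra.weak_filiform scale H brH (m - 1) V"
proof -
  interpret odd_quadratic_lie_superalgebra scale G br B by fact
  obtain u where pair: "central_odd_pair scale G br B em u"
    and U: "V (m - 1) = {v \<in> G 1. B v u = 0}"
    using weak_filiform_central_odd_pair[OF assms(5) _ assms(6)] \<open>m \<ge> 3\<close> by auto
  interpret central_odd_pair scale G br B em u by (rule pair)
  have V: "V (m - 1) = perp 1"
    using U form_odd[OF _ e_odd] by (auto simp: perp_def)
  note wf = assms(5) and m = \<open>m \<ge> 3\<close>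
  show ?thesis
    using perp_odd_quadratic dim_total
      is_generalized_odd_double_extension[OF perp_flag_top[OF wf m V]]
      perp_weak_filiform[OF wf m V]
    by (metis (no_types, lifting))
qed

end
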